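(* Let $C$ be a smooth cubic curve in $\mathbb{P}^2$ (over $\mathbb{C}$). Then the surface $X=\mathbb{P}^2\setminus C$ is dominable by $\mathbb{C}^2$.
   Context: A complex surface $X$ is dominable by $\mathbb{C}^2$ if there is a holomorphic map $F:\mathbb{C}^2\to X$ whose Jacobian determinant is not identically zero. *)

theory Defs
  imports "HOL-Analysis.Analysis"
begin

definition cproportional :: "complex^3 \<Rightarrow> complex^3 \<Rightarrow> bool" where
  "cproportional v w \<longleftrightarrow> v \<noteq> 0 \<and> w \<noteq> 0 \<and> (\<exists>c. c \<noteq> 0 \<and> v = c *s w)"

lemma part_equivp_cproportional: "part_equivp cproportional"
proof (rule part_equivpI)
  show "\<exists>x. cproportional x x"
    by (rule exI[of _ "axis 1 1"]) (auto simp: cproportional_def axis_eq_0_iff intro!: exI[of _ 1])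
  show "symp cproportional"
  proof (rule sympI)
    fix v w assume "cproportional v w"
    then obtain c where "v \<noteq> 0" "w \<noteq> 0" "c \<noteq> 0" "v = c *s w" by (auto simp: cproportional_def)
    then show "cproportional w v" 
      by (auto simp: cproportional_def vec_eq_iff intro!: exI[of _ "inverse c"])
  qed
  show "transp cproportional"
  proof (rule transpI)
    fix u v w assume "cproportional u v" "cproportional v w"
    then obtain c d where "u \<noteq> 0" "w \<noteq> 0" "c \<noteq> 0" "d \<noteq> 0" "u = (c * d) *s w"
      by (auto simp: cproportional_def vector_smult_assoc)
    then show "cproportional u w" unfolding cproportional_def
      by (metis mult_eq_0_iff)
  qed
qed

(* The complex projective plane. The abstraction cpoint v is the point with homogeneous
   coordinates v; cpoint 0 is unspecified, so v is always required to be nonzero. *)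
quotient_type cp2 = "complex^3" / partial: cproportional
  morphisms rep_cp2 cpoint
  by (rule part_equivp_cproportional)

instantiation cp2 :: topological_space
begin

(* quotient topology from the nonzero vectors *)
definition open_cp2 :: "cp2 set \<Rightarrow> bool" where
  "open_cp2 U \<longleftrightarrow> open {v. v \<noteq> 0 \<and> cpoint v \<in> U}"

instance
proof
  have "open (- {0 :: complex^3})" by (rule open_Compl) simp
  then show "open (UNIV :: cp2 set)" by (simp add: open_cp2_def Compl_eq)
next
  fix S T :: "cp2 set" assume "open S" "open T"
  moreover have "{v. v \<noteq> 0 \<and> cpoint v \<in> S \<inter> T} = {v. v \<noteq> 0 \<and> cpoint v \<in> S} \<inter> {v. v \<noteq> 0 \<and> cpoint v \<in> T}"
    by auto
  ultimately show "open (S \<inter> T)" by (auto simp: open_cp2_def)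
next
  fix K :: "cp2 set set" assume "\<forall>S\<in>K. open S"
  moreover have "{v. v \<noteq> 0 \<and> cpoint v \<in> \<Union>K} = (\<Union>S\<in>K. {v. v \<noteq> 0 \<and> cpoint v \<in> S})" by auto
  ultimately show "open (\<Union>K)" by (auto simp: open_cp2_def)
qed

end

(* The affine charts: index arithmetic in type 3 is modulo 3, so i + 1 and i + 2 are the two
   other indices, and the chart divides the other two coordinates by the i-th one.
   Outside cp2_dom i the value of cp2_chart i is irrelevant. *)
definition cp2_dom :: "3 \<Rightarrow> cp2 set" where
  "cp2_dom i = {cpoint v |v. v $ i \<noteq> 0}"

lift_definition cp2_chart :: "3 \<Rightarrow> cp2 \<Rightarrow> complex^2" is
  "\<lambda>i v. vector [v $ (i + 1) / v $ i, v $ (i + 2) / v $ i]"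
  by (auto simp: cproportional_def)

(* Intended for open S: the real Frechet derivative exists at each point of S and is
   linear over the complex numbers (the sort of *s here). *)
definition holomorphic_vec_on :: "(complex^'n \<Rightarrow> complex^'m) \<Rightarrow> (complex^'n) set \<Rightarrow> bool" where
  "holomorphic_vec_on f S \<longleftrightarrow>
     (\<forall>z\<in>S. \<exists>D. (f has_derivative D) (at z) \<and> Vector_Spaces.linear (*s) (*s) D)"

definition jacobian_det :: "(complex^'n \<Rightarrow> complex^'n) \<Rightarrow> complex^'n \<Rightarrow> complex" where
  "jacobian_det f z = det (matrix (frechet_derivative f (at z)))"

(* A surface is a topology together with a set of charts (domain, coordinate map). *)
type_synonym 'a atlas = "('a set \<times> ('a \<Rightarrow> complex^2)) set"

definition complex_surface :: "'a topology \<Rightarrow> 'a atlas \<Rightarrow> bool" where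
  "complex_surface X A \<longleftrightarrow>
     Hausdorff_space X \<and> second_countable X \<and> topspace X = (\<Union>(U, \<phi>)\<in>A. U) \<and>
     (\<forall>(U, \<phi>)\<in>A. openin X U \<and> open (\<phi> ` U) \<and>
        homeomorphic_map (subtopology X U) (top_of_set (\<phi> ` U)) \<phi>) \<and>
     (\<forall>(U, \<phi>)\<in>A. \<forall>(V, \<psi>)\<in>A. holomorphic_vec_on (\<psi> \<circ> inv_into U \<phi>) (\<phi> ` (U \<inter> V)))"

(* F is holomorphic if it is continuous and holomorphic in every chart. By the chain rule,
   (non)vanishing of the Jacobian determinant at z does not depend on the chart around F z. *)
definition dominable_by_C2 :: "'a topology \<Rightarrow> 'a atlas \<Rightarrow> bool" where
  "dominable_by_C2 X A \<longleftrightarrow>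
     (\<exists>F :: complex^2 \<Rightarrow> 'a. continuous_map euclidean X F \<and>
        (\<forall>(U, \<phi>)\<in>A. holomorphic_vec_on (\<phi> \<circ> F) (F -` U)) \<and>
        (\<exists>(U, \<phi>)\<in>A. \<exists>z. F z \<in> U \<and> jacobian_det (\<phi> \<circ> F) z \<noteq> 0))"

definition cp2_atlas_on :: "cp2 set \<Rightarrow> cp2 atlas" where
  "cp2_atlas_on S = (\<lambda>i. (cp2_dom i \<inter> S, cp2_chart i)) ` UNIV"

(* Homogeneous polynomial of degree d in three variables; a i j is the coefficient of
   x^i y^j z^(d - i - j). The index 3 is the element 0 of type 3. *)
definition ternary_form :: "nat \<Rightarrow> (nat \<Rightarrow> nat \<Rightarrow> complex) \<Rightarrow> complex^3 \<Rightarrow> complex" where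
  "ternary_form d a v =
     (\<Sum>i\<le>d. \<Sum>j\<le>d - i. a i j * v $ 1 ^ i * v $ 2 ^ j * v $ 3 ^ (d - i - j))"

definition partial_deriv :: "'n \<Rightarrow> (complex^'n \<Rightarrow> complex) \<Rightarrow> complex^'n \<Rightarrow> complex" where
  "partial_deriv i f v = deriv (\<lambda>t. f (v + t *s axis i 1)) 0"

(* The gradient condition excludes the zero form and forms with multiple factors. *)
definition smooth_plane_curve :: "nat \<Rightarrow> cp2 set \<Rightarrow> bool" where
  "smooth_plane_curve d C \<longleftrightarrow>
     (\<exists>a. C = {cpoint v |v. v \<noteq> 0 \<and> ternary_form d a v = 0} \<and>
        (\<forall>v. v \<noteq> 0 \<and> ternary_form d a v = 0 \<longrightarrow>
           (\<exists>i. partial_deriv i (ternary_form d a) v \<noteq> 0)))"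

(* An open subset of the plane, and so the complement of a smooth curve, is a complex surface
   with the restricted charts. *)


lemma cproportional_refl: "v \<noteq> 0 \<Longrightarrow> cproportional v v"
  by (auto simp: cproportional_def intro!: exI[of _ 1])

lemma cpoint_eq_iff:
  assumes "v \<noteq> 0" "w \<noteq> 0"
  shows "cpoint v = cpoint w \<longleftrightarrow> (\<exists>c. c \<noteq> 0 \<and> v = c *s w)"
proof -
  have "cproportional v w \<longleftrightarrow> cpoint v = cpoint w"
    using Quotient3_rel[OF Quotient3_cp2, of v w] cproportional_refl assms by simp
  then show ?thesis using assms by (simp add: cproportional_def)
qed

lemma rep_cp2_nonzero: "rep_cp2 p \<noteq> 0" and cpoint_rep_cp2: "cpoint (rep_cp2 p) = p"
proof -
  have "cproportional (rep_cp2 p) (rep_cp2 p)" "cpoint (rep_cp2 p) = p"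
    by (rule Quotient3_rep_reflp[OF Quotient3_cp2], rule Quotient3_abs_rep[OF Quotient3_cp2])
  then show "rep_cp2 p \<noteq> 0" "cpoint (rep_cp2 p) = p" by (auto simp: cproportional_def)
qed

lemma cpoint_cases: obtains v where "v \<noteq> 0" "p = cpoint v"
  using rep_cp2_nonzero cpoint_rep_cp2 by metis

lemma cp2_chart_cpoint:
  "v \<noteq> 0 \<Longrightarrow> cp2_chart i (cpoint v) = vector [v $ (i + 1) / v $ i, v $ (i + 2) / v $ i]"
  by (rule cp2_chart.abs_eq) (rule cproportional_refl)

lemma cpoint_in_dom_iff: "v \<noteq> 0 \<Longrightarrow> cpoint v \<in> cp2_dom i \<longleftrightarrow> v $ i \<noteq> 0"
proof
  assume "v \<noteq> 0" "cpoint v \<in> cp2_dom i"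
  then obtain w where w: "cpoint v = cpoint w" "w $ i \<noteq> 0" by (auto simp: cp2_dom_def)
  then have "w \<noteq> 0" by auto
  then obtain c where "c \<noteq> 0" "v = c *s w" using cpoint_eq_iff w(1) \<open>v \<noteq> 0\<close> by blast
  then show "v $ i \<noteq> 0" using w(2) by simp
qed (auto simp: cp2_dom_def)

lemma continuous_on_cpoint: "continuous_on (- {0}) cpoint"
  unfolding continuous_on_open_vimage[OF open_Compl[OF closed_singleton]]
proof (intro allI impI)
  fix B :: "cp2 set" assume "open B"
  moreover have "cpoint -` B \<inter> - {0} = {v. v \<noteq> 0 \<and> cpoint v \<in> B}" by auto
  ultimately show "open (cpoint -` B \<inter> - {0})" by (simp add: open_cp2_def)
qed

definition cp2_param :: "3 \<Rightarrow> complex^2 \<Rightarrow> complex^3" where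
  "cp2_param i w = (\<chi> k. if k = i then 1 else if k = i + 1 then w $ 1 else w $ 2)"

lemma type3: "(i :: 3) + 1 \<noteq> i" "(i :: 3) + 2 \<noteq> i" "(i :: 3) + 1 \<noteq> i + 2"
  "k = i \<or> k = i + 1 \<or> k = (i :: 3) + 2"
proof -
  have "\<forall>i k :: 3. i + 1 \<noteq> i \<and> i + 2 \<noteq> i \<and> i + 1 \<noteq> i + 2 \<and> (k = i \<or> k = i + 1 \<or> k = i + 2)"
    by (simp add: forall_3)
  then show "(i :: 3) + 1 \<noteq> i" "(i :: 3) + 2 \<noteq> i" "(i :: 3) + 1 \<noteq> i + 2"
  "k = i \<or> k = i + 1 \<or> k = (i :: 3) + 2" by blast+
qed

lemma cp2_param_simps [simp]:
  "cp2_param i w $ i = 1" "cp2_param i w $ (i + 1) = w $ 1" "cp2_param i w $ (i + 2) = w $ 2"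
  "cp2_param i w \<noteq> 0"
proof -
  show *: "cp2_param i w $ i = 1" "cp2_param i w $ (i + 1) = w $ 1" "cp2_param i w $ (i + 2) = w $ 2"
    using type3[of i] by (simp_all add: cp2_param_def)
  show "cp2_param i w \<noteq> 0" using *(1) by (metis zero_index zero_neq_one)
qed

lemma cp2_param_in_dom: "cpoint (cp2_param i w) \<in> cp2_dom i"
  by (simp add: cpoint_in_dom_iff)

lemma chart_param: "cp2_chart i (cpoint (cp2_param i w)) = w"
proof -
  have "cp2_chart i (cpoint (cp2_param i w)) = vector [w $ 1, w $ 2]"
    by (simp add: cp2_chart_cpoint)
  then show ?thesis by (simp add: vec_eq_iff forall_2)
qed

lemma param_chart:
  assumes "p \<in> cp2_dom i" shows "cpoint (cp2_param i (cp2_chart i p)) = p"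
proof -
  obtain v where v: "v \<noteq> 0" "p = cpoint v" by (rule cpoint_cases)
  then have vi: "v $ i \<noteq> 0" using assms cpoint_in_dom_iff by blast
  have "cp2_param i (cp2_chart i p) $ k = (inverse (v $ i) *s v) $ k" for k
    using type3(4)[of k i] vi v by (auto simp: cp2_chart_cpoint divide_inverse mult.commute)
  then have "cp2_param i (cp2_chart i p) = inverse (v $ i) *s v" by (simp add: vec_eq_iff)
  then show ?thesis using vi v by (subst v(2), subst cpoint_eq_iff) (auto intro!: exI[of _ "inverse (v $ i)"])
qed

lemma continuous_on_param: "continuous_on UNIV (\<lambda>w. cpoint (cp2_param i w))"
proof (rule continuous_on_compose2[OF continuous_on_cpoint])
  show "continuous_on UNIV (cp2_param i)"
    unfolding cp2_param_def
  proof (rule continuous_on_vec_lambda)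
    fix k
    show "continuous_on UNIV (\<lambda>w. if k = i then 1 else if k = i + 1 then w $ 1 else w $ 2)"
      by (cases "k = i"; cases "k = i + 1") (auto intro!: continuous_intros)
  qed
qed auto

lemma open_cp2_dom: "open (cp2_dom i)"
proof -
  have "{v. v \<noteq> 0 \<and> cpoint v \<in> cp2_dom i} = {v. v $ i \<noteq> 0}"
    by (metis cpoint_in_dom_iff zero_index)
  moreover have "open {v :: complex^3. v $ i \<noteq> 0}"
    by (intro open_Collect_neq continuous_intros)
  ultimately show ?thesis by (simp add: open_cp2_def)
qed

lemma continuous_on_cp2_chart: "continuous_on (cp2_dom i) (cp2_chart i)"
  unfolding continuous_on_open_vimage[OF open_cp2_dom]
proof (intro allI impI)
  fix B :: "(complex^2) set" assume B: "open B"
  define f :: "complex^3 \<Rightarrow> complex^2" where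
    "f = (\<lambda>v. \<chi> k. if k = 1 then v $ (i + 1) / v $ i else v $ (i + 2) / v $ i)"
  have f: "cp2_chart i (cpoint v) = f v" if "v \<noteq> 0" for v
    using that by (simp add: cp2_chart_cpoint f_def vec_eq_iff forall_2)
  have quot: "continuous_on {v :: complex^3. v $ i \<noteq> 0} (\<lambda>v. v $ j / v $ i)" for j
    by (intro continuous_on_divide continuous_on_component continuous_on_id) simp
  have "continuous_on {v. v $ i \<noteq> 0} f" unfolding f_def
  proof (rule continuous_on_vec_lambda)
    fix k :: 2
    show "continuous_on {v :: complex^3. v $ i \<noteq> 0} (\<lambda>v. if k = 1 then v $ (i + 1) / v $ i else v $ (i + 2) / v $ i)"
      by (cases "k = 1") (simp_all add: quot)
  qed
  moreover have o: "open {v :: complex^3. v $ i \<noteq> 0}"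
    by (intro open_Collect_neq continuous_intros)
  ultimately have "open (f -` B \<inter> {v. v $ i \<noteq> 0})"
    using B continuous_on_open_vimage by blast
  moreover have "{v. v \<noteq> 0 \<and> cpoint v \<in> cp2_chart i -` B \<inter> cp2_dom i} = f -` B \<inter> {v. v $ i \<noteq> 0}"
  proof (rule set_eqI)
    fix v
    show "v \<in> {v. v \<noteq> 0 \<and> cpoint v \<in> cp2_chart i -` B \<inter> cp2_dom i} \<longleftrightarrow> v \<in> f -` B \<inter> {v. v $ i \<noteq> 0}"
      by (cases "v = 0") (auto simp: cpoint_in_dom_iff f)
  qed
  ultimately show "open (cp2_chart i -` B \<inter> cp2_dom i)" by (simp add: open_cp2_def)
qed

lemma cp2_separated:
  fixes p q :: cp2 assumes "p \<noteq> q"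
  shows "\<exists>U V. open U \<and> open V \<and> p \<in> U \<and> q \<in> V \<and> disjnt U V"
proof -
  obtain v w where v: "v \<noteq> 0" "p = cpoint v" and w: "w \<noteq> 0" "q = cpoint w" by (metis cpoint_cases)
  obtain i where i: "v $ i \<noteq> 0" using v(1) by (auto simp: vec_eq_iff)
  define m where "m x j = x $ i * v $ j - x $ j * v $ i" for x :: "complex^3" and j
  obtain j where j: "m w j \<noteq> 0"
  proof (rule ccontr)
    assume "\<not> thesis"
    then have m0: "m w j = 0" for j using that by blast
    define c where "c = w $ i / v $ i"
    have "w $ j = c * v $ j" for j using m0[of j] i by (simp add: m_def c_def field_simps)
    then have eq: "w = c *s v" unfolding vec_eq_iff vector_smult_component by blast
    then have "c \<noteq> 0" using w(1) by auto
    then have "cpoint w = cpoint v" using cpoint_eq_iff[OF w(1) v(1)] eq by blast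
    then have "q = p" using v w by simp
    then show False using assms by simp
  qed
  define g where "g x = cmod (m x j) / norm x" for x
  have scale: "g (c *s x) = g x" if "c \<noteq> 0" for c x
  proof -
    have "norm (c *s x) = cmod c * norm x"
      by (simp add: norm_vec_def L2_set_left_distrib norm_mult L2_set_right_distrib)
    moreover have "m (c *s x) j = c * m x j" by (simp add: m_def algebra_simps)
    ultimately show ?thesis using that by (simp add: g_def norm_mult)
  qed
  have cont: "continuous_on (- {0}) g"
    unfolding g_def m_def by (intro continuous_intros) auto
  define G where "G = g \<circ> rep_cp2"
  have G: "G (cpoint x) = g x" if x: "x \<noteq> 0" for x
  proof -
    obtain c where "c \<noteq> 0" "rep_cp2 (cpoint x) = c *s x"
      using cpoint_eq_iff[OF rep_cp2_nonzero x] cpoint_rep_cp2 by blast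
    then show ?thesis by (simp add: G_def scale)
  qed
  have op: "open (G -` B)" if "open B" for B
  proof -
    have "{v. v \<noteq> 0 \<and> cpoint v \<in> G -` B} = g -` B \<inter> - {0}" using G by auto
    moreover have "open (g -` B \<inter> - {0})"
      using cont that continuous_on_open_vimage[OF open_Compl[OF closed_singleton]] by blast
    ultimately show ?thesis by (simp add: open_cp2_def)
  qed
  have "G p = 0" "G q \<noteq> 0"
    using v w j by (simp_all add: G g_def) (simp add: m_def)
  then obtain A B where "open A" "open B" "G p \<in> A" "G q \<in> B" "A \<inter> B = {}"
    using hausdorff by metis
  then have "open (G -` A)" "open (G -` B)" "p \<in> G -` A" "q \<in> G -` B" "disjnt (G -` A) (G -` B)"
    using op by (auto simp: disjnt_iff)
  then show ?thesis by blast
qed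

lemma second_countable_cp2: "second_countable (euclidean :: cp2 topology)"
proof (rule second_countable_open_map_image)
  show "open_map (top_of_set (- {0})) euclidean cpoint"
    unfolding open_map_def
  proof (intro allI impI)
    fix W :: "(complex^3) set" assume "openin (top_of_set (- {0})) W"
    then have W: "open W" "W \<subseteq> - {0}" using openin_open_eq[OF open_Compl[OF closed_singleton]] by auto
    have "{v. v \<noteq> 0 \<and> cpoint v \<in> cpoint ` W} = (\<Union>c\<in>-{0}. (\<lambda>v. c *s v) -` W)"
    proof (rule set_eqI, rule iffI)
      fix v assume "v \<in> {v. v \<noteq> 0 \<and> cpoint v \<in> cpoint ` W}"
      then obtain w where "v \<noteq> 0" "w \<in> W" "cpoint w = cpoint v" by auto
      then obtain c where "c \<noteq> 0" "w = c *s v" using cpoint_eq_iff W(2) by (metis ComplD insertI1 subsetD)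
      then show "v \<in> (\<Union>c\<in>-{0}. (\<lambda>v. c *s v) -` W)" using \<open>w \<in> W\<close> by auto
    next
      fix v assume "v \<in> (\<Union>c\<in>-{0}. (\<lambda>v. c *s v) -` W)"
      then obtain c where c: "c \<noteq> 0" "c *s v \<in> W" by auto
      then have n: "c *s v \<noteq> 0" using W(2) by auto
      then have "v \<noteq> 0" by auto
      moreover have "cpoint (c *s v) = cpoint v" using c n \<open>v \<noteq> 0\<close> cpoint_eq_iff by blast
      ultimately show "v \<in> {v. v \<noteq> 0 \<and> cpoint v \<in> cpoint ` W}" using c by (auto intro: rev_image_eqI)
    qed
    moreover have "open ((\<lambda>v. c *s v) -` W)" for c
    proof -
      have "continuous_on UNIV (\<lambda>v :: complex^3. c *s v)"
        unfolding vector_scalar_mult_def by (intro continuous_intros)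
      then show ?thesis using W(1) open_vimage by blast
    qed
    ultimately show "openin euclidean (cpoint ` W)" by (auto simp: open_cp2_def)
  qed
  show "continuous_map (top_of_set (- {0})) euclidean cpoint"
    using continuous_on_cpoint by simp
  show "cpoint ` topspace (top_of_set (- {0})) = topspace euclidean"
    by (auto intro: cpoint_cases)
  show "second_countable (top_of_set (- {0 :: complex^3}))"
  proof (rule second_countable_subtopology)
    obtain B :: "(complex^3) set set" where B: "countable B" "topological_basis B"
      using ex_countable_basis by blast
    then show "second_countable (euclidean :: (complex^3) topology)"
      unfolding second_countable_def
    proof (intro exI[of _ B] conjI ballI allI impI)
      show "countable B" by (fact B(1))
    next
      fix V assume "V \<in> B"
      then show "openin euclidean V" using topological_basis_open[OF B(2)] by simp
    next
      fix U and x :: "complex^3" assume "openin euclidean U \<and> x \<in> U"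
      then have "open U" "x \<in> U" by simp_all
      then show "\<exists>V\<in>B. x \<in> V \<and> V \<subseteq> U" using topological_basisE[OF B(2)] by metis
    qed
  qed
qed

lemma has_derivative_vec_components:
  fixes f :: "complex^'n \<Rightarrow> complex^'m"
  assumes "\<And>k. ((\<lambda>w. f w $ k) has_derivative (\<lambda>h. D h $ k)) (at z)"
  shows "(f has_derivative D) (at z :: (complex^'n) filter)"
proof (subst has_derivative_componentwise_within, intro ballI)
  fix b :: "complex^'m" assume "b \<in> Basis"
  then obtain k u where b: "b = axis k u" by (auto simp: Basis_vec_def)
  have "((\<lambda>w. f w $ k \<bullet> u) has_derivative (\<lambda>h. D h $ k \<bullet> u)) (at z)"
    by (intro has_derivative_inner_left assms)
  then show "((\<lambda>x. f x \<bullet> b) has_derivative (\<lambda>x. D x \<bullet> b)) (at z)"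
    by (simp add: b inner_axis)
qed

lemma transition_holomorphic:
  "holomorphic_vec_on (\<lambda>w. cp2_chart j (cpoint (cp2_param i w))) {w. cp2_param i w $ j \<noteq> 0}"
  unfolding holomorphic_vec_on_def
proof
  fix z assume "z \<in> {w. cp2_param i w $ j \<noteq> 0}"
  then have nz: "cp2_param i z $ j \<noteq> 0" by simp
  define P where "P h = (\<chi> k. if k = i then 0 else if k = i + 1 then h $ 1 else h $ 2)" for h :: "complex^2"
  have der: "((\<lambda>w. cp2_param i w $ k) has_derivative (\<lambda>h. P h $ k)) (at z)" for k
    by (cases "k = i"; cases "k = i + 1")
       (auto simp: cp2_param_def P_def intro!: derivative_eq_intros bounded_linear.has_derivative[OF bounded_linear_vec_nth])
  define q where "q k h = (P h $ k * cp2_param i z $ j - cp2_param i z $ k * P h $ j) / (cp2_param i z $ j * cp2_param i z $ j)" for k h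
  define D :: "complex^2 \<Rightarrow> complex^2" where "D h = vector [q (j + 1) h, q (j + 2) h]" for h
  have dq: "((\<lambda>w. cp2_param i w $ k / cp2_param i w $ j) has_derivative q k) (at z)" for k
    by (rule has_derivative_eq_rhs[OF has_derivative_divide[OF der der nz]])
       (use nz in \<open>auto simp: q_def fun_eq_iff field_simps\<close>)
  have "((\<lambda>w. cp2_chart j (cpoint (cp2_param i w))) has_derivative D) (at z)"
  proof (rule has_derivative_vec_components)
    fix k :: 2
    show "((\<lambda>w. cp2_chart j (cpoint (cp2_param i w)) $ k) has_derivative (\<lambda>h. D h $ k)) (at z)"
      using exhaust_2[of k] dq[of "j + 1"] dq[of "j + 2"]
      by (auto simp: cp2_chart_cpoint D_def)
  qed
  moreover have "Vector_Spaces.linear (*s) (*s) D"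
    by unfold_locales
       (auto simp: D_def q_def P_def vec_eq_iff forall_2 algebra_simps add_divide_distrib diff_divide_distrib)
  ultimately show "\<exists>D. ((\<lambda>w. cp2_chart j (cpoint (cp2_param i w))) has_derivative D) (at z)
      \<and> Vector_Spaces.linear (*s) (*s) D" by blast
qed

lemma complex_surface_cp2_open:
  assumes S: "open S"
  shows "complex_surface (top_of_set S) (cp2_atlas_on S)"
proof -
  have img: "cp2_chart i ` (cp2_dom i \<inter> T) = {w. cpoint (cp2_param i w) \<in> T}" for i T
  proof (intro set_eqI iffI)
    fix w assume "w \<in> {w. cpoint (cp2_param i w) \<in> T}"
    then show "w \<in> cp2_chart i ` (cp2_dom i \<inter> T)"
      using chart_param[of i w] cp2_param_in_dom[of i w] by (intro rev_image_eqI[of "cpoint (cp2_param i w)"]) auto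
  qed (auto simp: param_chart)
  have op: "open (cp2_chart i ` (cp2_dom i \<inter> T))" if "open T" for i T
    unfolding img using open_vimage[OF that continuous_on_param, of i] by (simp add: vimage_def)
  have inj: "inj_on (cp2_chart i) (cp2_dom i)" for i
    by (metis inj_onI param_chart)
  have H: "Hausdorff_space (top_of_set S)"
    by (rule Hausdorff_space_subtopology) (use cp2_separated in \<open>auto simp: Hausdorff_space_def\<close>)
  have cover: "(\<Union>i. cp2_dom i \<inter> S) = S"
  proof -
    have "\<exists>i. p \<in> cp2_dom i" for p
    proof -
      obtain v where v: "v \<noteq> 0" "p = cpoint v" by (rule cpoint_cases)
      then obtain i where "v $ i \<noteq> 0" by (auto simp: vec_eq_iff)
      then show ?thesis using v cpoint_in_dom_iff by blast
    qed
    then show ?thesis by auto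
  qed
  have homeo: "homeomorphic_map (subtopology (top_of_set S) (cp2_dom i \<inter> S))
      (top_of_set (cp2_chart i ` (cp2_dom i \<inter> S))) (cp2_chart i)" for i
  proof -
    have "homeomorphic_maps (top_of_set (cp2_dom i \<inter> S)) (top_of_set (cp2_chart i ` (cp2_dom i \<inter> S)))
      (cp2_chart i) (\<lambda>w. cpoint (cp2_param i w))"
      unfolding homeomorphic_maps_def
      using continuous_on_subset[OF continuous_on_cp2_chart, of "cp2_dom i \<inter> S"]
        continuous_on_subset[OF continuous_on_param, of "cp2_chart i ` (cp2_dom i \<inter> S)"]
      by (auto simp: param_chart chart_param)
    then show ?thesis
      by (auto simp: subtopology_subtopology Int_absorb1 Int_commute inf.assoc intro: homeomorphic_maps_imp_map)
  qed
  have trans: "holomorphic_vec_on (cp2_chart j \<circ> inv_into (cp2_dom i \<inter> S) (cp2_chart i))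
      (cp2_chart i ` ((cp2_dom i \<inter> S) \<inter> (cp2_dom j \<inter> S)))" for i j
    unfolding holomorphic_vec_on_def
  proof
    fix z assume z: "z \<in> cp2_chart i ` ((cp2_dom i \<inter> S) \<inter> (cp2_dom j \<inter> S))" (is "z \<in> ?I")
    have I: "?I = cp2_chart i ` (cp2_dom i \<inter> (cp2_dom j \<inter> S))" by (rule arg_cong[where f = "image _"]) auto
    have oI: "open ?I" unfolding I by (intro op open_Int open_cp2_dom S)
    have eq: "cp2_chart j (cpoint (cp2_param i w))
        = (cp2_chart j \<circ> inv_into (cp2_dom i \<inter> S) (cp2_chart i)) w" if wI: "w \<in> ?I" for w
    proof -
      obtain p where p: "p \<in> cp2_dom i \<inter> S" "w = cp2_chart i p" using wI by blast
      then have "inv_into (cp2_dom i \<inter> S) (cp2_chart i) w = p"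
        using inj[of i] by (simp add: inv_into_f_f inj_on_Int)
      then show ?thesis using p param_chart by simp
    qed
    have "cpoint (cp2_param i z) \<in> cp2_dom j" using z unfolding I img by auto
    then have "cp2_param i z $ j \<noteq> 0" by (simp add: cpoint_in_dom_iff)
    then obtain D where D: "((\<lambda>w. cp2_chart j (cpoint (cp2_param i w))) has_derivative D) (at z)"
        "Vector_Spaces.linear (*s) (*s) D"
      using transition_holomorphic[of j i] by (auto simp: holomorphic_vec_on_def)
    have "((cp2_chart j \<circ> inv_into (cp2_dom i \<inter> S) (cp2_chart i)) has_derivative D) (at z)"
      by (rule has_derivative_transform_within_open[OF D(1) oI z]) (rule eq)
    with D(2) show "\<exists>D. ((cp2_chart j \<circ> inv_into (cp2_dom i \<inter> S) (cp2_chart i)) has_derivative D) (at z)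
      \<and> Vector_Spaces.linear (*s) (*s) D"
      by blast
  qed
  have o: "openin (top_of_set S) (cp2_dom i \<inter> S)" for i
    unfolding openin_open_eq[OF S] using open_Int[OF open_cp2_dom S] by blast
  have "topspace (top_of_set S) = (\<Union>(U, \<phi>)\<in>cp2_atlas_on S. U)"
    using cover by (simp add: cp2_atlas_on_def image_image)
  moreover have "second_countable (top_of_set S)"
    by (rule second_countable_subtopology[OF second_countable_cp2])
  moreover have "\<forall>(U, \<phi>)\<in>cp2_atlas_on S. openin (top_of_set S) U \<and> open (\<phi> ` U) \<and>
      homeomorphic_map (subtopology (top_of_set S) U) (top_of_set (\<phi> ` U)) \<phi>"
    unfolding cp2_atlas_on_def using o op[OF S] homeo by blast
  moreover have "\<forall>(U, \<phi>)\<in>cp2_atlas_on S. \<forall>(V, \<psi>)\<in>cp2_atlas_on S.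
      holomorphic_vec_on (\<psi> \<circ> inv_into U \<phi>) (\<phi> ` (U \<inter> V))"
    unfolding cp2_atlas_on_def using trans by blast
  ultimately show ?thesis using H unfolding complex_surface_def by blast
qed

lemma ternary_form_smult: "ternary_form d a (c *s v) = c ^ d * ternary_form d a v"
proof -
  have "a i j * (c * v $ 1) ^ i * (c * v $ 2) ^ j * (c * v $ 3) ^ (d - i - j)
      = c ^ d * (a i j * v $ 1 ^ i * v $ 2 ^ j * v $ 3 ^ (d - i - j))" if "i \<le> d" "j \<le> d - i" for i j
  proof -
    have "c ^ d = c ^ i * (c ^ j * c ^ (d - i - j))"
      using that by (simp flip: power_add)
    then show ?thesis by (simp only: power_mult_distrib ac_simps)
  qed
  then show ?thesis
    unfolding ternary_form_def sum_distrib_left vector_smult_component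
    by (intro sum.cong refl) auto
qed

lemma open_Compl_smooth_plane_curve:
  assumes "smooth_plane_curve d C" shows "open (- C)"
proof -
  obtain a where C: "C = {cpoint v |v. v \<noteq> 0 \<and> ternary_form d a v = 0}"
    using assms by (auto simp: smooth_plane_curve_def)
  have "cpoint v \<in> C \<longleftrightarrow> ternary_form d a v = 0" if v: "v \<noteq> 0" for v
  proof
    assume "cpoint v \<in> C"
    then obtain w where w: "w \<noteq> 0" "ternary_form d a w = 0" "cpoint v = cpoint w" using C by blast
    then obtain c where "v = c *s w" using cpoint_eq_iff[OF v w(1)] by blast
    then show "ternary_form d a v = 0" using w(2) by (simp add: ternary_form_smult)
  qed (use v C in blast)
  then have "{v. v \<noteq> 0 \<and> cpoint v \<in> - C} = - {0} \<inter> {v. ternary_form d a v \<noteq> 0}" by auto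
  moreover have "open {v. ternary_form d a v \<noteq> 0}"
    unfolding ternary_form_def by (intro open_Collect_neq continuous_intros)
  ultimately show ?thesis by (simp add: open_cp2_def open_Int open_Compl)
qed

lemma complex_surface_Compl_smooth_plane_curve:
  assumes "smooth_plane_curve d C"
  shows "complex_surface (top_of_set (- C)) (cp2_atlas_on (- C))"
  by (rule complex_surface_cp2_open[OF open_Compl_smooth_plane_curve[OF assms]])

end

theory Submission
  imports Defs "HOL-Computational_Algebra.Fundamental_Theorem_Algebra"
begin

text \<open>Let \<open>F = y\<^sup>2 z - x\<^sup>3 - a x z\<^sup>2 - b z\<^sup>3\<close>, after moving a flex to \<open>(0 : 1 : 0)\<close>. The affine
  surface \<open>F = 1\<close> covers the complement of the cubic, so it suffices to dominate that surface.
  The planes through its line \<open>z = 0, x = -1\<close> cut out a family of conics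
  \<open>A u\<^sup>2 + B u + 3 p = \<sigma> y\<^sup>2\<close> over the \<open>\<sigma>\<close>-line, and a line on the surface over a second flex meets
  every conic with finite \<open>\<sigma>\<close> once and so provides a section. The complex flow that is
  Hamiltonian for the conic in each plane is affine linear; it is given by the entire functions
  \<open>cosh (\<surd>\<Delta> w)\<close> and \<open>sinh (\<surd>\<Delta> w) / \<surd>\<Delta>\<close> with \<open>\<Delta> = 4 A \<sigma>\<close>. Flowing the section gives the
  required map in the variables \<open>\<sigma>\<close> and \<open>w\<close>.\<close>

section \<open>Roots of complex polynomials and determinants in C^3\<close>

lemma complex_poly_root:
  fixes p :: "complex poly"
  assumes "coeff p n \<noteq> 0" "n > 0"
  obtains z where "poly p z = 0"
proof -
  have "degree p > 0"
    using assms le_degree[of p n] by simp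
  then have "\<not> constant (poly p)"
    by (simp add: constant_degree)
  then show thesis
    using fundamental_theorem_of_algebra that by blast
qed

lemma complex_quadratic_root:
  fixes a b c :: complex
  obtains x y where "x \<noteq> 0 \<or> y \<noteq> 0" "a * x^2 + b * x * y + c * y^2 = 0"
proof (cases "a = 0")
  case True
  then show thesis using that[of 1 0] by simp
next
  case False
  then obtain z where "poly [:c, b, a:] z = 0"
    using complex_poly_root[of "[:c, b, a:]" 2] by (auto simp: numeral_2_eq_2)
  then show thesis
    using that[of z 1] by (simp add: algebra_simps power2_eq_square)
qed

abbreviation det3 :: "complex^3 \<Rightarrow> complex^3 \<Rightarrow> complex^3 \<Rightarrow> complex" where
  "det3 u v w \<equiv> det (vector [u, v, w])"

lemma det3_cramer: "det3 a b c *s v = det3 v b c *s a + det3 a v c *s b + det3 a b v *s c"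
  by (simp add: vec_eq_iff forall_3 det_3; algebra)

lemma det3_coords:
  "det3 (x1 *s a + y1 *s b + z1 *s c) (x2 *s a + y2 *s b + z2 *s c) (x3 *s a + y3 *s b + z3 *s c)
    = det3 (vector [x1, y1, z1]) (vector [x2, y2, z2]) (vector [x3, y3, z3]) * det3 a b c"
  by (simp add: det_3; algebra)

lemma det3_nonzero_extend:
  assumes "a \<noteq> 0" "\<And>k. b \<noteq> k *s a"
  obtains c where "det3 a b c \<noteq> 0"
proof (rule ccontr)
  assume "\<not> thesis"
  then have *: "det3 a b c = 0" for c using that by blast
  obtain i where i: "a $ i \<noteq> 0" using assms(1) by (auto simp: vec_eq_iff)
  \<comment> \<open>The three unit vectors in place of c show that all 2x2 minors of a and b
    vanish.\<close>
  have "a $ i * b $ j = b $ i * a $ j" for j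
    using *[of "axis 1 1"] *[of "axis 2 1"] *[of "axis 3 1"] exhaust_3[of i] exhaust_3[of j]
    by (auto simp: det_3 axis_def algebra_simps)
  then have "b = (b $ i / a $ i) *s a"
    using i by (simp add: vec_eq_iff field_simps)
  then show False using assms(2) by blast
qed

section \<open>Ternary cubics as symmetric trilinear forms\<close>

locale symmetric_trilinear =
  fixes T :: "complex^3 \<Rightarrow> complex^3 \<Rightarrow> complex^3 \<Rightarrow> complex"
  assumes swap12: "T u v w = T v u w"
    and swap23: "T u v w = T u w v"
    and add1: "T (u + u') v w = T u v w + T u' v w"
    and scale1: "T (c *s u) v w = c * T u v w"
begin

lemma add2: "T v (u + u') w = T v u w + T v u' w"
  using add1 swap12 by metis

lemma add3: "T v w (u + u') = T v w u + T v w u'"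
  using add2 swap23 by metis

lemma scale2: "T v (c *s u) w = c * T v u w"
  using scale1 swap12 by metis

lemma scale3: "T v w (c *s u) = c * T v w u"
  using scale2 swap23 by metis

lemma diff1: "T (u - u') v w = T u v w - T u' v w"
  using add1[of "u - u'" u'] by simp

lemma diff2: "T v (u - u') w = T v u w - T v u' w"
  using diff1 swap12 by metis

lemma diff3: "T v w (u - u') = T v w u - T v w u'"
  using diff2 swap23 by metis

lemma zero3: "T v w 0 = 0"
  using scale3[of v w 0 0] by simp

lemmas multilinear = add1 add2 add3 diff1 diff2 diff3 scale1 scale2 scale3

lemma cubic_expand:
  "T (x *s a + y *s b + z *s c) (x *s a + y *s b + z *s c) (x *s a + y *s b + z *s c)
    = x^3 * T a a a + y^3 * T b b b + z^3 * T c c c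
      + 3 * (x^2 * y * T a a b + x^2 * z * T a a c + x * y^2 * T a b b + y^2 * z * T b b c
             + x * z^2 * T a c c + y * z^2 * T b c c) + 6 * (x * y * z * T a b c)"
  by (simp add: multilinear swap12 swap23 algebra_simps power2_eq_square power3_eq_cube)

end

text \<open>Each coefficient is spread evenly over the 1, 3 or 6 orderings of its monomial, which
  makes \<open>T\<close> symmetric and restores the coefficient on the diagonal.\<close>

lemma ternary_cubic_polarization:
  obtains T where "symmetric_trilinear T" "\<And>v. ternary_form 3 a v = T v v v"
proof -
  define T :: "complex^3 \<Rightarrow> complex^3 \<Rightarrow> complex^3 \<Rightarrow> complex" where
    "T u v w = a 3 0 * (u$1 * v$1 * w$1) + a 0 3 * (u$2 * v$2 * w$2) + a 0 0 * (u$3 * v$3 * w$3)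
      + a 2 1 / 3 * (u$1 * v$1 * w$2 + u$1 * v$2 * w$1 + u$2 * v$1 * w$1)
      + a 2 0 / 3 * (u$1 * v$1 * w$3 + u$1 * v$3 * w$1 + u$3 * v$1 * w$1)
      + a 1 2 / 3 * (u$2 * v$2 * w$1 + u$2 * v$1 * w$2 + u$1 * v$2 * w$2)
      + a 0 2 / 3 * (u$2 * v$2 * w$3 + u$2 * v$3 * w$2 + u$3 * v$2 * w$2)
      + a 1 0 / 3 * (u$3 * v$3 * w$1 + u$3 * v$1 * w$3 + u$1 * v$3 * w$3)
      + a 0 1 / 3 * (u$3 * v$3 * w$2 + u$3 * v$2 * w$3 + u$2 * v$3 * w$3)
      + a 1 1 / 6 * (u$1 * v$2 * w$3 + u$1 * v$3 * w$2 + u$2 * v$1 * w$3 + u$2 * v$3 * w$1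
                     + u$3 * v$1 * w$2 + u$3 * v$2 * w$1)" for u v w
  have "symmetric_trilinear T"
    by unfold_locales (simp_all add: T_def algebra_simps add_divide_distrib)
  moreover have "ternary_form 3 a v = T v v v" for v
  proof -
    have "{..3::nat} = {0, 1, 2, 3}" "{..2::nat} = {0, 1, 2}" "{..1::nat} = {0, 1}"
      by auto
    then show ?thesis
      by (simp add: ternary_form_def T_def power2_eq_square power3_eq_cube)
  qed
  ultimately show thesis by (rule that)
qed

section \<open>Flexes and the Weierstrass form of a nonsingular cubic\<close>

context symmetric_trilinear
begin

text \<open>\<open>3 * T v v w\<close> is the derivative of the cubic at v in the direction w, so
  this is the Jacobian criterion without coordinates.\<close>

definition nonsingular :: bool where
  "nonsingular \<longleftrightarrow> (\<forall>v. v \<noteq> 0 \<longrightarrow> T v v v = 0 \<longrightarrow> (\<exists>w. T v v w \<noteq> 0))"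

lemma cubic_zero:
  obtains p where "p \<noteq> 0" "T p p p = 0"
proof -
  define a b :: "complex^3" where "a = axis 1 1" and "b = axis 2 1"
  show thesis
  proof (cases "T b b b = 0")
    case True
    then show thesis using that[of b] by (simp add: b_def axis_eq_0_iff)
  next
    case False
    \<comment> \<open>\<open>P\<close> is the cubic at a + t b, a polynomial in t with leading
      coefficient \<open>T b b b\<close>.\<close>
    define P where "P = [:T a a a, 3 * T a a b, 3 * T a b b, T b b b:]"
    have "coeff P 3 \<noteq> 0"
      using False by (simp add: P_def numeral_3_eq_3)
    then obtain t where t: "poly P t = 0"
      by (rule complex_poly_root) simp_all
    let ?p = "1 *s a + t *s b + 0 *s 0"
    have "T ?p ?p ?p = poly P t"
      unfolding cubic_expand by (simp add: zero3 P_def algebra_simps power2_eq_square power3_eq_cube)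
    moreover have "?p $ 1 = 1"
      by (simp add: a_def b_def axis_def)
    then have "?p \<noteq> 0" by (metis zero_index zero_neq_one)
    ultimately show thesis
      using t that by simp
  qed
qed

text \<open>Serves to show that the linear form \<open>T u v\<close> is zero once it vanishes on a
  basis.\<close>

lemma trilinear_cramer:
  "det3 a b c * T u v w = det3 w b c * T u v a + det3 a w c * T u v b + det3 a b w * T u v c"
  using arg_cong[OF det3_cramer, of "T u v" a b c w] by (simp add: multilinear)

lemma tangent_frame:
  assumes nonsingular
  obtains p e f where "det3 p e f \<noteq> 0" "T p p p = 0" "T p p e = 0" "T p p f \<noteq> 0"
proof -
  obtain p where p: "p \<noteq> 0" "T p p p = 0" by (rule cubic_zero)
  then obtain f where f: "T p p f \<noteq> 0"
    using assms by (auto simp: nonsingular_def)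
  have "f \<noteq> k *s p" for k
    using f p(2) by (auto simp: scale3)
  then obtain c where c: "det3 p f c \<noteq> 0"
    using det3_nonzero_extend[OF p(1)] by blast
  \<comment> \<open>This \<open>k\<close> moves c along f into the kernel of \<open>T p p\<close>,
    that is, onto the tangent line at p.\<close>
  define k where "k = T p p c / T p p f"
  define e where "e = c - k *s f"
  have "c = e + k *s f" by (simp add: e_def)
  then have "T p p c = T p p e + k * T p p f" by (metis add3 scale3)
  then have "T p p e = 0" using f by (simp add: k_def)
  moreover have "det3 p e f = - det3 p f c"
    by (simp add: e_def det_3 algebra_simps)
  ultimately show thesis
    using that[of p e f] c f p by simp
qed

text \<open>The tangent at \<open>p\<close> is spanned by \<open>p\<close> and \<open>e\<close>, and \<open>e\<close> is its residual intersection with the cubic.\<close>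

lemma nonflex_normal_form:
  assumes "det3 p e0 f0 \<noteq> 0" "T p p p = 0" "T p p e0 = 0" "T p p f0 \<noteq> 0" "T p e0 e0 \<noteq> 0"
  obtains e f where "det3 p e f \<noteq> 0" "T p p e = 0" "T e e e = 0" "T p e e = 1/3" "T p p f = 1/3"
    "T p e f = 0" "T e e f = 0"
proof -
  \<comment> \<open>\<open>k\<close> puts e on the cubic, \<open>r\<close> and the factor in
    \<open>g\<close> normalize \<open>T p e e\<close> and \<open>T p p f\<close> to 1/3, and the two
    corrections in \<open>f\<close> cancel \<open>T p e f\<close> and
    \<open>T e e f\<close>.\<close>
  define r where "r = csqrt (1 / (3 * T p e0 e0))"
  define k where "k = - T e0 e0 e0 / (3 * T p e0 e0)"
  define e where "e = r *s (e0 + k *s p)"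
  define g where "g = (1 / (3 * T p p f0)) *s f0"
  define f where "f = g + (- 3 * T p e g) *s e + (- 3 * T e e g) *s p"
  have "r^2 * T p e0 e0 = 1/3" and r0: "r \<noteq> 0"
    using assms(5) by (simp_all add: r_def)
  then have r: "r * (r * T p e0 e0) = 1/3"
    by (simp only: power2_eq_square mult.assoc)
  have perm: "T e0 p p = 0" "T p e0 p = 0" "T e0 p e0 = T p e0 e0" "T e0 e0 p = T p e0 e0"
    using assms(3) swap12 swap23 by metis+
  have ppe: "T p p e = 0"
    using assms(2,3) by (simp add: e_def multilinear)
  have pee: "T p e e = 1/3"
    using r assms(2,3) by (simp add: e_def multilinear perm)
  have eee: "T e e e = 0"
    using assms(2,3,5) by (simp add: e_def multilinear perm k_def)
  have ppg: "T p p g = 1/3"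
    using assms(4) by (simp add: g_def multilinear)
  have perm': "T e p p = 0" "T p e p = 0" "T e p e = 1/3" "T e e p = 1/3"
    using ppe pee swap12 swap23 by metis+
  have "det3 p e f = r / (3 * T p p f0) * det3 p e0 f0"
    by (simp add: f_def e_def g_def det_3) algebra
  then have "det3 p e f \<noteq> 0" using assms r0 by simp
  moreover have "T p p f = 1/3" "T p e f = 0" "T e e f = 0"
    by (simp_all add: f_def multilinear ppg ppe pee eee perm' assms(2))
  ultimately show thesis
    using that[of e f] ppe pee eee by simp
qed

text \<open>In the frame of \<open>nonflex_normal_form\<close> the cubic is
  \<open>y\<^sup>2 z + x\<^sup>2 y + q y z\<^sup>2 + s x z\<^sup>2 + t z\<^sup>3\<close>; here \<open>m (x + d z)\<^sup>3\<close> is its restriction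
  to the line \<open>y = m x + c z\<close>, and \<open>\<epsilon> = d - m\<close>.\<close>

lemma flex_line_parameters:
  fixes q s t :: complex
  assumes "s \<noteq> 0"
  obtains m c d where "m^2 + c = 3 * m * d" "2 * m * c + q * m + s = 3 * m * d^2"
    "c^2 + q * c + t = m * d^3"
proof -
  \<comment> \<open>With \<epsilon> = d - m the first equation gives c = 2 m^2 + 3 m \<epsilon>. The
    second becomes 3 m \<epsilon>^2 = K and then the third 3 A = - \<epsilon> B. Squaring eliminates
    \<epsilon> and leaves \<open>P\<close>.\<close>
  define K A B where "K m = m^3 + q * m + s" and "A m = 5 * m^4 + 4 * q * m^2 + 2 * s * m + t"
    and "B m = 26 * m^3 + 8 * q * m - s" for m
  define P where "P = [:0, 27:] * [:t, 2 * s, 4 * q, 0, 5:]^2 - [:s, q, 0, 1:] * [:-s, 8 * q, 0, 26:]^2"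
  \<comment> \<open>The leading coefficient is 27 * 5^2 - 26^2 = -1.\<close>
  have "coeff P 9 \<noteq> 0"
    by (simp add: P_def power2_eq_square eval_nat_numeral)
  then obtain m where "poly P m = 0"
    by (rule complex_poly_root) simp_all
  moreover have "poly P m = 27 * m * (A m)^2 - K m * (B m)^2"
    by (simp add: P_def A_def B_def K_def eval_nat_numeral algebra_simps)
  ultimately have N: "27 * m * (A m)^2 = K m * (B m)^2"
    by simp
  \<comment> \<open>At m = 0 the equation reads 0 = s^3.\<close>
  have m: "m \<noteq> 0"
    using N assms by (auto simp: K_def B_def)
  define \<epsilon>0 where "\<epsilon>0 = csqrt (K m / (3 * m))"
  have \<epsilon>0: "3 * m * \<epsilon>0^2 = K m"
    using m by (simp add: \<epsilon>0_def)
  have "3 * m * ((3 * A m)^2 - (\<epsilon>0 * B m)^2) = 0"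
    using N \<epsilon>0 by algebra
  then have "(3 * A m)^2 = (\<epsilon>0 * B m)^2"
    using m by simp
  then have "3 * A m = - (- \<epsilon>0 * B m) \<or> 3 * A m = - (\<epsilon>0 * B m)"
    unfolding power2_eq_iff by auto
  \<comment> \<open>\<open>K m\<close> determines \<epsilon> only up to sign; the third equation
    selects the sign.\<close>
  then obtain \<epsilon> where \<epsilon>: "3 * m * \<epsilon>^2 = K m" "3 * A m = - (\<epsilon> * B m)"
    using \<epsilon>0 by (metis power2_minus)
  show thesis
  proof
    show "m^2 + (2 * m^2 + 3 * m * \<epsilon>) = 3 * m * (m + \<epsilon>)"
      by algebra
    show "2 * m * (2 * m^2 + 3 * m * \<epsilon>) + q * m + s = 3 * m * (m + \<epsilon>)^2"
      using \<epsilon>(1) unfolding K_def by algebra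
    have *: "3 * ((2 * m^2 + 3 * m * \<epsilon>)^2 + q * (2 * m^2 + 3 * m * \<epsilon>) + t) = 3 * (m * (m + \<epsilon>)^3)"
      using \<epsilon> unfolding K_def A_def B_def by algebra
    show "(2 * m^2 + 3 * m * \<epsilon>)^2 + q * (2 * m^2 + 3 * m * \<epsilon>) + t = m * (m + \<epsilon>)^3"
      by (rule mult_left_cancel[THEN iffD1, OF _ *]) simp
  qed
qed

text \<open>The last three equations say that on the line through p and e the cubic is a multiple of
  a cube vanishing at p. Starting from a point that is not a flex, such a line is found by solving
  for its coefficients in the normal form.\<close>

lemma exists_flex:
  assumes nonsingular
  obtains p e f where "det3 p e f \<noteq> 0" "T p p p = 0" "T p p e = 0" "T p e e = 0"
proof -
  obtain p e0 f0 where 0: "det3 p e0 f0 \<noteq> 0" "T p p p = 0" "T p p e0 = 0" "T p p f0 \<noteq> 0"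
    using assms by (rule tangent_frame)
  show thesis
  proof (cases "T p e0 e0 = 0")
    case True
    then show thesis using 0 that by blast
  next
    case False
    then obtain e f where *: "det3 p e f \<noteq> 0" "T p p e = 0" "T e e e = 0" "T p e e = 1/3"
        "T p p f = 1/3" "T p e f = 0" "T e e f = 0"
      using 0 nonflex_normal_form by blast
    show thesis
    proof (cases "T e f f = 0")
      case True
      \<comment> \<open>On the line through e and f the cubic is now \<open>T f f f * z^3\<close>,
        so e is a flex.\<close>
      have "det3 e f p = det3 p e f"
        by (simp add: det_3)
      then show thesis using True * that[of e f p] by simp
    next
      case False
      obtain m c d where mcd: "m^2 + c = 3 * m * d" "2 * m * c + 3 * T p f f * m + 3 * T e f f = 3 * m * d^2"
          "c^2 + 3 * T p f f * c + T f f f = m * d^3"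
        using flex_line_parameters[of "3 * T e f f" "3 * T p f f" "T f f f"] False by auto
      \<comment> \<open>On the line y = m x + c z, \<open>p'\<close> is the point with x + d z = 0
        and \<open>e'\<close> the one with z = 0. Hence the cubic at u p' + w e' is m w^3.\<close>
      define p' e' where "p' = f + (- d) *s e + (c - d * m) *s p" and "e' = e + m *s p"
      have perm: "T e p p = 0" "T p e p = 0" "T e p e = 1/3" "T e e p = 1/3" "T p f p = 1/3" "T f p p = 1/3"
        "T p f e = 0" "T e p f = 0" "T e f p = 0" "T f p e = 0" "T f e p = 0" "T e f e = 0" "T f e e = 0"
        "T f p f = T p f f" "T f f p = T p f f" "T f e f = T e f f" "T f f e = T e f f"
        using * swap12 swap23 by metis+
      note expand = p'_def e'_def multilinear perm * 0(2)
      have "det3 p' e' p = - det3 p e f"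
        by (simp add: p'_def e'_def det_3) algebra
      moreover have "T p' p' p' = 0"
      proof -
        have "3 * T p' p' p' = 0"
          using mcd by (simp add: expand) algebra
        then show ?thesis by simp
      qed
      moreover have "T p' p' e' = 0"
      proof -
        have "3 * T p' p' e' = 0"
          using mcd by (simp add: expand) algebra
        then show ?thesis by simp
      qed
      moreover have "T p' e' e' = 0"
      proof -
        have "3 * T p' e' e' = 0"
          using mcd by (simp add: expand) algebra
        then show ?thesis by simp
      qed
      ultimately show thesis
        using that[of p' e' p] * by simp
    qed
  qed
qed

text \<open>The flex removes y^3, x y^2 and x^2 y. Nonsingularity makes the coefficients of y^2 z
  and x^3 nonzero, so they can be scaled to 1 and -1, and shears of the frame then remove x y z, x^2
  z and y z^2.\<close>

lemma weierstrass_form: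
  assumes nonsingular
  obtains e p f a b where "det3 e p f \<noteq> 0"
    "\<forall>x y z. T (x *s e + y *s p + z *s f) (x *s e + y *s p + z *s f) (x *s e + y *s p + z *s f)
      = y^2 * z - x^3 - a * x * z^2 - b * z^3"
proof -
  obtain p e0 f0 where 0: "det3 p e0 f0 \<noteq> 0" "T p p p = 0" "T p p e0 = 0" "T p e0 e0 = 0"
    using assms by (rule exists_flex)
  have perm0: "T e0 p p = 0" "T p e0 p = 0" "T e0 p e0 = 0" "T e0 e0 p = 0" 
    using 0 swap12 swap23 by metis+
  have singular: "v = 0" if "T v v v = 0" "T v v p = 0" "T v v e0 = 0" "T v v f0 = 0" for v
  proof (rule ccontr)
    assume "v \<noteq> 0"
    then obtain w where "T v v w \<noteq> 0"
      using assms that(1) by (auto simp: nonsingular_def)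
    then show False
      using trilinear_cramer[of p e0 f0 v v w] that 0(1) by simp
  qed
  have "p \<noteq> 0" using 0(1) by (auto simp: det_3)
  then have ppf: "T p p f0 \<noteq> 0"
    using singular[of p] 0 by auto
  \<comment> \<open>Otherwise the cubic contains the line through p and e0. Along it only the
    derivative towards f0 can be nonzero; this is a binary quadratic form, and a zero of it is a
    singular point.\<close>
  have eee: "T e0 e0 e0 \<noteq> 0"
  proof
    assume eee: "T e0 e0 e0 = 0"
    obtain x y where xy: "x \<noteq> 0 \<or> y \<noteq> 0" "T e0 e0 f0 * x^2 + 2 * T p e0 f0 * x * y + T p p f0 * y^2 = 0"
      by (rule complex_quadratic_root)
    define v where "v = x *s e0 + y *s p"
    have "T v v f0 = 0"
      using xy(2) swap12[of e0 p f0] by (simp add: v_def multilinear algebra_simps power2_eq_square)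
    moreover have "T v v v = 0" "T v v p = 0" "T v v e0 = 0"
      by (simp_all add: v_def multilinear 0 perm0 eee)
    ultimately have "v = 0" using singular by blast
    moreover have "det3 p v f0 = x * det3 p e0 f0" "det3 v e0 f0 = y * det3 p e0 f0"
      by (simp_all add: v_def det_3; algebra)+
    ultimately show False using xy(1) 0(1) by (auto simp: det_3)
  qed
  have "coeff [:1, 0, 0, T e0 e0 e0:] 3 \<noteq> 0"
    using eee by (simp add: numeral_3_eq_3)
  then obtain r where "poly [:1, 0, 0, T e0 e0 e0:] r = 0"
    by (rule complex_poly_root) simp_all
  then have "1 + r^3 * T e0 e0 e0 = 0"
    by (simp add: power3_eq_cube algebra_simps)
  then have "r^3 * T e0 e0 e0 = -1"
    by (simp add: eq_neg_iff_add_eq_0 add.commute)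
  then have r: "r * (r * (r * T e0 e0 e0)) = -1"
    by (simp only: power3_eq_cube mult.assoc)
  then have r0: "r \<noteq> 0" by auto
  \<comment> \<open>The multiple of p in \<open>e\<close> cancels \<open>T p e f\<close>, that of e
    in \<open>f2\<close> cancels \<open>T e e f\<close>, and that of p in \<open>f\<close> cancels
    \<open>T p f f\<close>.\<close>
  define f1 where "f1 = (1 / (3 * T p p f0)) *s f0"
  define e where "e = r *s e0 + (- 3 * r * T p e0 f1) *s p"
  define f2 where "f2 = f1 + T e e f1 *s e"
  define f where "f = f2 + (- 3/2 * T p f2 f2) *s p"
  have e: "T p p e = 0" "T p e e = 0" "T e e e = -1"
    using r by (simp_all add: e_def multilinear 0 perm0)
  have perm: "T e p p = 0" "T p e p = 0" "T e p e = 0" "T e e p = 0"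
    using e swap12 swap23 by metis+
  have f1: "T p p f1 = 1/3"
    using ppf by (simp add: f1_def multilinear)
  have "T p e f1 = 0"
    by (simp add: e_def multilinear f1)
  then have f2: "T p p f2 = 1/3" "T p e f2 = 0" "T e e f2 = 0"
    by (simp_all add: f2_def multilinear e f1 perm)
  then have f: "T p p f = 1/3" "T p e f = 0" "T e e f = 0"
    by (simp_all add: f_def multilinear e perm 0(2))
  have pf2p: "T p f2 p = 1/3" using f2(1) swap23 by metis
  have pff: "T p f f = 0"
    by (simp add: f_def multilinear 0(2) f2 pf2p)
  have "det3 e p f = - r / (3 * T p p f0) * det3 p e0 f0"
    by (simp add: f_def f2_def f1_def e_def det_3) algebra
  then have "det3 e p f \<noteq> 0" using 0(1) ppf r0 by simp
  moreover have "T (x *s e + y *s p + z *s f) (x *s e + y *s p + z *s f) (x *s e + y *s p + z *s f)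
      = y^2 * z - x^3 - (- 3 * T e f f) * x * z^2 - (- T f f f) * z^3" for x y z
    unfolding cubic_expand by (simp add: e perm f pff 0(2) swap12[of e p f])
  ultimately show thesis using that by blast
qed

end

section \<open>The entire functions of the flow\<close>

text \<open>As cosh is even and sinh is odd, cosh (sqrt x) and sinh (sqrt x) / sqrt x are power
  series in x itself. Every x is the square of \<open>csqrt x\<close>, so they converge everywhere,
  and the identity is cosh^2 - sinh^2 = 1.\<close>

lemma entire_cosh_sqrt:
  obtains C S :: "complex \<Rightarrow> complex" and C' S'
  where "\<And>x. (C has_field_derivative C' x) (at x)" "\<And>x. (S has_field_derivative S' x) (at x)"
    "\<And>x. (C x)^2 - x * (S x)^2 = 1" "C 0 = 1" "S 0 = 1"
proof -
  define c s :: "nat \<Rightarrow> complex" where "c n = 1 / fact (2 * n)" and "s n = 1 / fact (2 * n + 1)" for n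
  have c: "(\<lambda>n. c n * (y^2)^n) sums cosh y" for y
  proof -
    have "(\<lambda>n. if even (2 * n) then y ^ (2 * n) /\<^sub>R fact (2 * n) else 0) sums cosh y"
      by (subst sums_mono_reindex[of "\<lambda>n. 2 * n" "\<lambda>n. if even n then y ^ n /\<^sub>R fact n else 0"])
        (auto simp: strict_mono_def cosh_converges elim!: evenE)
    then show ?thesis
      unfolding power_mult[symmetric] by (simp add: c_def scaleR_conv_of_real field_simps)
  qed
  have s: "(\<lambda>n. y * (s n * (y^2)^n)) sums sinh y" for y
  proof -
    have "(\<lambda>n. if even (2 * n + 1) then 0 else y ^ (2 * n + 1) /\<^sub>R fact (2 * n + 1)) sums sinh y"
      by (subst sums_mono_reindex[of "\<lambda>n. 2 * n + 1" "\<lambda>n. if even n then 0 else y ^ n /\<^sub>R fact n"])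
        (auto simp: strict_mono_def sinh_converges elim!: oddE)
    then show ?thesis
      unfolding power_mult[symmetric] by (simp add: s_def scaleR_conv_of_real field_simps)
  qed
  define C S where "C x = (\<Sum>n. c n * x^n)" and "S x = (\<Sum>n. s n * x^n)" for x
  have C: "summable (\<lambda>n. c n * x^n)" for x
    using sums_summable[OF c[of "csqrt x"]] by simp
  have S: "summable (\<lambda>n. s n * x^n)" for x
  proof (cases "x = 0")
    case False
    then show ?thesis
      using sums_summable[OF s[of "csqrt x"]] by (simp add: summable_cmult_iff)
  qed simp
  have "(C x)^2 - x * (S x)^2 = 1" for x
  proof -
    have "C x = cosh (csqrt x)"
      using sums_unique[OF c[of "csqrt x"]] by (simp add: C_def)
    moreover have "csqrt x * S x = sinh (csqrt x)"
      using sums_unique[OF s[of "csqrt x"]] suminf_mult[OF S[of x], of "csqrt x"] by (simp add: S_def)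
    moreover have "x * (S x)^2 = (csqrt x * S x)^2"
      by (simp add: power_mult_distrib)
    ultimately show ?thesis
      using hyperbolic_pythagoras[of "csqrt x"] by simp
  qed
  moreover have "C 0 = 1" "S 0 = 1"
    unfolding C_def S_def powser_zero by (simp_all add: c_def s_def)
  ultimately show thesis
    using that[of C "\<lambda>x. \<Sum>n. diffs c n * x^n" S "\<lambda>x. \<Sum>n. diffs s n * x^n"]
      termdiffs_strong_converges_everywhere[OF C, folded C_def]
      termdiffs_strong_converges_everywhere[OF S, folded S_def]
    by simp
qed

section \<open>Holomorphic functions of two variables through their partial derivatives\<close>

named_theorems has_partials_intros

text \<open>The form of the derivative forces it to be complex linear, and the explicit numbers let
  introduction rules compute it.\<close>

definition has_partials :: "(complex^2 \<Rightarrow> complex) \<Rightarrow> complex \<Rightarrow> complex \<Rightarrow> complex^2 \<Rightarrow> bool" where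
  "has_partials g a b z \<longleftrightarrow> (g has_derivative (\<lambda>h. a * h $ 1 + b * h $ 2)) (at z)"

lemma has_partials_eq_rhs:
  "has_partials g a b z \<Longrightarrow> a = a' \<Longrightarrow> b = b' \<Longrightarrow> has_partials g a' b' z"
  by simp

lemma has_partials_const [has_partials_intros]: "has_partials (\<lambda>_. c) 0 0 z"
  by (simp add: has_partials_def)

lemma has_partials_fst [has_partials_intros]: "has_partials (\<lambda>z. z $ 1) 1 0 z"
  and has_partials_snd [has_partials_intros]: "has_partials (\<lambda>z. z $ 2) 0 1 z"
  by (simp_all add: has_partials_def bounded_linear.has_derivative[OF bounded_linear_vec_nth])

lemma has_partials_add [has_partials_intros]:
  assumes "has_partials f a b z" "has_partials g c d z"
  shows "has_partials (\<lambda>z. f z + g z) (a + c) (b + d) z"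
  using has_derivative_add[OF assms[unfolded has_partials_def]]
  by (simp add: has_partials_def algebra_simps)

lemma has_partials_diff [has_partials_intros]:
  assumes "has_partials f a b z" "has_partials g c d z"
  shows "has_partials (\<lambda>z. f z - g z) (a - c) (b - d) z"
  using has_derivative_diff[OF assms[unfolded has_partials_def]]
  by (simp add: has_partials_def algebra_simps)

lemma has_partials_mult [has_partials_intros]:
  assumes "has_partials f a b z" "has_partials g c d z"
  shows "has_partials (\<lambda>z. f z * g z) (f z * c + a * g z) (f z * d + b * g z) z"
  using has_derivative_mult[OF assms[unfolded has_partials_def]]
  by (simp add: has_partials_def algebra_simps)

lemma has_partials_compose:
  assumes "(\<phi> has_field_derivative d) (at (f z))" "has_partials f a b z"
  shows "has_partials (\<lambda>z. \<phi> (f z)) (d * a) (d * b) z"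
  using has_derivative_compose[OF assms(2)[unfolded has_partials_def] assms(1)[unfolded has_field_derivative_def]]
  by (simp add: has_partials_def algebra_simps)

lemma has_partials_divide:
  assumes "has_partials f a b z" "has_partials g c d z" "g z \<noteq> 0"
  shows "has_partials (\<lambda>z. f z / g z) ((a * g z - f z * c) / (g z)^2) ((b * g z - f z * d) / (g z)^2) z"
  unfolding has_partials_def
  by (rule has_derivative_eq_rhs[OF has_derivative_divide[OF assms(1,2)[unfolded has_partials_def] assms(3)]])
    (use assms(3) in \<open>simp add: fun_eq_iff field_simps power2_eq_square\<close>)

definition entire2 :: "(complex^2 \<Rightarrow> complex) \<Rightarrow> bool" where
  "entire2 g \<longleftrightarrow> (\<forall>z. \<exists>a b. has_partials g a b z)"

lemma entire2_const: "entire2 (\<lambda>_. c)"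
  and entire2_fst: "entire2 (\<lambda>z. z $ 1)"
  and entire2_snd: "entire2 (\<lambda>z. z $ 2)"
  and entire2_add: "entire2 f \<Longrightarrow> entire2 g \<Longrightarrow> entire2 (\<lambda>z. f z + g z)"
  and entire2_diff: "entire2 f \<Longrightarrow> entire2 g \<Longrightarrow> entire2 (\<lambda>z. f z - g z)"
  and entire2_mult: "entire2 f \<Longrightarrow> entire2 g \<Longrightarrow> entire2 (\<lambda>z. f z * g z)"
  unfolding entire2_def by (blast intro: has_partials_intros)+

lemma entire2_compose:
  "(\<And>x. (\<phi> has_field_derivative \<phi>' x) (at x)) \<Longrightarrow> entire2 f \<Longrightarrow> entire2 (\<lambda>z. \<phi> (f z))"
  unfolding entire2_def by (blast intro: has_partials_compose)

lemmas entire2_intros = entire2_const entire2_fst entire2_snd entire2_add entire2_diff entire2_mult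

lemma vector2_has_partials:
  assumes "has_partials f a b z" "has_partials g c d z"
  defines "D \<equiv> \<lambda>h :: complex^2. vector [a * h $ 1 + b * h $ 2, c * h $ 1 + d * h $ 2] :: complex^2"
  shows "((\<lambda>z. vector [f z, g z] :: complex^2) has_derivative D) (at z)"
    and "Vector_Spaces.linear (*s) (*s) D"
    and "jacobian_det (\<lambda>z. vector [f z, g z]) z = a * d - b * c"
proof -
  show D: "((\<lambda>z. vector [f z, g z] :: complex^2) has_derivative D) (at z)"
  proof (rule has_derivative_vec_components)
    fix k :: 2
    show "((\<lambda>w. (vector [f w, g w] :: complex^2) $ k) has_derivative (\<lambda>h. D h $ k)) (at z)"
      using exhaust_2[of k] assms by (auto simp: has_partials_def)
  qed
  show "Vector_Spaces.linear (*s) (*s) D"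
    by unfold_locales (auto simp: D_def vec_eq_iff forall_2 algebra_simps)
  show "jacobian_det (\<lambda>z. vector [f z, g z]) z = a * d - b * c"
    unfolding jacobian_det_def frechet_derivative_at[OF D, symmetric]
    by (simp add: det_2 matrix_def D_def axis_def)
qed

section \<open>Jacobian determinants of maps into the projective plane\<close>

text \<open>A cyclic shift of the columns preserves a 3x3 determinant, so one formula serves all
  three charts.\<close>

lemma det_3_cyclic:
  fixes v a b :: "complex^3"
  shows "v $ i * (a $ (i + 1) * b $ (i + 2) - a $ (i + 2) * b $ (i + 1))
    - v $ (i + 1) * (a $ i * b $ (i + 2) - a $ (i + 2) * b $ i)
    + v $ (i + 2) * (a $ i * b $ (i + 1) - a $ (i + 1) * b $ i) = det (vector [v, a, b])"
proof -
  have index: "(1 :: 3) + 1 = 2" "(1 :: 3) + 2 = 3" "(2 :: 3) + 1 = 3" "(2 :: 3) + 2 = 1"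
    "(3 :: 3) + 1 = 1" "(3 :: 3) + 2 = 2"
    by simp_all
  consider "i = 1" | "i = 2" | "i = 3"
    using exhaust_3[of i] by blast
  then show ?thesis
    by cases (simp_all only: index det_3 vector_3, simp_all add: algebra_simps)
qed

text \<open>Read (v, v1, v2) as a vector function of two variables with partial derivatives (a, a1,
  a2) and (b, b1, b2). The left side is v^3 times the Jacobian determinant of (v1 / v, v2 / v), the
  right side the determinant of the three vectors.\<close>

lemma quotient_jacobian:
  fixes v :: complex
  assumes "v \<noteq> 0"
  shows "((a1 * v - v1 * a) / v^2 * ((b2 * v - v2 * b) / v^2)
      - (b1 * v - v1 * b) / v^2 * ((a2 * v - v2 * a) / v^2)) * v^3
    = v * (a1 * b2 - a2 * b1) - v1 * (a * b2 - a2 * b) + v2 * (a * b1 - a1 * b)"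
proof -
  have *: "x / v^2 * (y / v^2) = x * y / v^4" for x y
    by (simp flip: power_add)
  let ?N = "(a1 * v - v1 * a) * (b2 * v - v2 * b) - (b1 * v - v1 * b) * (a2 * v - v2 * a)"
  let ?R = "v * (a1 * b2 - a2 * b1) - v1 * (a * b2 - a2 * b) + v2 * (a * b1 - a1 * b)"
  have eq: "?N * v^3 = ?R * v^4"
    by algebra
  have "?N / v^4 * v^3 = ?N * v^3 / v^4"
    by (rule times_divide_eq_left)
  also have "\<dots> = ?R"
    unfolding eq using assms by simp
  finally show ?thesis
    unfolding * diff_divide_distrib[symmetric] .
qed

text \<open>In chart i the Jacobian determinant is that of f and its two partial derivatives divided
  by \<open>(f z $ i)^3\<close>, so a single determinant decides in every chart.\<close>

lemma dominable_by_lift: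
  fixes f :: "complex^2 \<Rightarrow> complex^3"
  assumes hol: "\<And>k. entire2 (\<lambda>z. f z $ k)"
    and nz: "\<And>z. f z \<noteq> 0"
    and S: "\<And>z. cpoint (f z) \<in> S"
    and ab: "\<And>k. has_partials (\<lambda>z. f z $ k) (a $ k) (b $ k) z0"
    and det: "det (vector [f z0, a, b] :: complex^3^3) \<noteq> 0"
  shows "dominable_by_C2 (top_of_set S) (cp2_atlas_on S)"
proof -
  define F where "F z = cpoint (f z)" for z
  have chart: "cp2_chart i \<circ> F = (\<lambda>z. vector [f z $ (i + 1) / f z $ i, f z $ (i + 2) / f z $ i])" for i
    by (simp add: F_def fun_eq_iff cp2_chart_cpoint nz)
  have dom: "F z \<in> cp2_dom i \<inter> S \<longleftrightarrow> f z $ i \<noteq> 0" for z i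
    by (simp add: F_def S cpoint_in_dom_iff nz)
  have "continuous_on UNIV F"
  proof -
    have "continuous (at z) f" for z
    proof -
      have "isCont (\<lambda>z. f z $ k) z" for k
        using hol[of k] has_derivative_continuous unfolding entire2_def has_partials_def by blast
      then show ?thesis
        unfolding continuous_within by (intro vec_tendstoI)
    qed
    then have "continuous_on UNIV f"
      by (simp add: continuous_on_eq_continuous_at)
    then have "continuous_on UNIV (cpoint \<circ> f)"
      using nz by (intro continuous_on_compose continuous_on_subset[OF continuous_on_cpoint]) auto
    then show ?thesis by (simp add: F_def[abs_def] comp_def)
  qed
  then have cont: "continuous_map euclidean (top_of_set S) F"
    using S by (auto simp: F_def continuous_map_in_subtopology)
  have holo: "holomorphic_vec_on (cp2_chart i \<circ> F) (F -` (cp2_dom i \<inter> S))" for i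
    unfolding holomorphic_vec_on_def
  proof
    fix z assume "z \<in> F -` (cp2_dom i \<inter> S)"
    then have "f z $ i \<noteq> 0" using dom by blast
    then have "\<exists>a b. has_partials (\<lambda>z. f z $ k / f z $ i) a b z" for k
      using hol[of k] hol[of i] has_partials_divide unfolding entire2_def by blast
    then obtain a1 b1 a2 b2 where
      "has_partials (\<lambda>z. f z $ (i + 1) / f z $ i) a1 b1 z"
      "has_partials (\<lambda>z. f z $ (i + 2) / f z $ i) a2 b2 z"
      by meson
    from vector2_has_partials(1,2)[OF this]
    show "\<exists>D. ((cp2_chart i \<circ> F) has_derivative D) (at z) \<and> Vector_Spaces.linear (*s) (*s) D"
      unfolding chart by blast
  qed
  obtain i where i: "f z0 $ i \<noteq> 0"
    using nz[of z0] by (auto simp: vec_eq_iff)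
  have "jacobian_det (cp2_chart i \<circ> F) z0 * (f z0 $ i)^3 = det (vector [f z0, a, b] :: complex^3^3)"
    unfolding chart vector2_has_partials(3)[OF has_partials_divide[OF ab ab i] has_partials_divide[OF ab ab i]]
      quotient_jacobian[OF i]
    by (rule det_3_cyclic)
  then have J: "jacobian_det (cp2_chart i \<circ> F) z0 \<noteq> 0"
    using det by auto
  show ?thesis
    unfolding dominable_by_C2_def
  proof (intro exI[of _ F] conjI)
    show "\<forall>(U, \<phi>)\<in>cp2_atlas_on S. holomorphic_vec_on (\<phi> \<circ> F) (F -` U)"
      using holo by (simp add: cp2_atlas_on_def)
    have "(cp2_dom i \<inter> S, cp2_chart i) \<in> cp2_atlas_on S"
      by (simp add: cp2_atlas_on_def)
    then show "\<exists>(U, \<phi>)\<in>cp2_atlas_on S. \<exists>z. F z \<in> U \<and> jacobian_det (\<phi> \<circ> F) z \<noteq> 0"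
      by (rule rev_bexI) (unfold split_conv, use J dom i in \<open>intro exI[of _ z0] conjI; simp\<close>)
  qed (rule cont)
qed

section \<open>A nondegenerate map from C^2 to the affine surface\<close>

text \<open>Then \<open>y = m x + c z\<close> is the tangent of \<open>y\<^sup>2 z = x\<^sup>3 + a x z\<^sup>2 + b z\<^sup>3\<close> at a flex with \<open>x = m\<^sup>2/3\<close>, \<open>z = 1\<close>.\<close>

lemma weierstrass_flex:
  fixes a b :: complex
  obtains m c where "2 * m * c = a - m^4 / 3" "c^2 = b + m^6 / 27"
proof -
  \<comment> \<open>Squaring the first equation eliminates c; the leading coefficient of
    \<open>P\<close> is 1/9 - 4/27. The sign of c is chosen afterwards.\<close>
  define P where "P = [:a, 0, 0, 0, -1/3:]^2 - [:0, 0, 4:] * [:b, 0, 0, 0, 0, 0, 1/27:]"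
  have "coeff P 8 \<noteq> 0"
    by (simp add: P_def power2_eq_square eval_nat_numeral)
  then obtain m where "poly P m = 0"
    by (rule complex_poly_root) simp_all
  moreover have "poly P m = (a - m^4 / 3)^2 - 4 * m^2 * (b + m^6 / 27)"
    by (simp add: P_def eval_nat_numeral algebra_simps)
  ultimately have m: "(a - m^4 / 3)^2 = (2 * m * csqrt (b + m^6 / 27))^2"
    by (simp add: power_mult_distrib)
  then consider "2 * m * csqrt (b + m^6 / 27) = a - m^4 / 3" | "2 * m * (- csqrt (b + m^6 / 27)) = a - m^4 / 3"
    unfolding power2_eq_iff by fastforce
  then show thesis
  proof cases
    case 1
    show thesis using that[OF 1] by simp
  next
    case 2
    show thesis using that[OF 2] by simp
  qed
qed

lemma weierstrass_map:
  fixes a b :: complex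
  obtains x y z :: "complex^2 \<Rightarrow> complex" and X Y Z :: "complex^2"
  where "entire2 x" "entire2 y" "entire2 z"
    "\<forall>\<tau>. (y \<tau>)^2 * z \<tau> - (x \<tau>)^3 - a * x \<tau> * (z \<tau>)^2 - b * (z \<tau>)^3 = 1"
    "has_partials x (X $ 1) (X $ 2) 0" "has_partials y (Y $ 1) (Y $ 2) 0" "has_partials z (Z $ 1) (Z $ 2) 0"
    "det3 (vector [x 0, y 0, z 0]) (vector [X $ 1, Y $ 1, Z $ 1]) (vector [X $ 2, Y $ 2, Z $ 2]) \<noteq> 0"
proof -
  obtain m c where mc: "2 * m * c = a - m^4 / 3" "c^2 = b + m^6 / 27"
    by (rule weierstrass_flex)
  define x1 where "x1 = m^2 / 3"
  have x1: "m^2 = 3 * x1" "2 * m * c = a - 3 * x1^2" "c^2 = b + x1^3"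
    using mc by (simp_all add: x1_def power_divide eval_nat_numeral)
  have "coeff [:1, 1, 1::complex:] 2 \<noteq> 0"
    by (simp add: numeral_2_eq_2)
  then obtain \<omega> :: complex where "poly [:1, 1, 1:] \<omega> = 0"
    by (rule complex_poly_root) simp_all
  then have \<omega>: "1 + \<omega> + \<omega>^2 = 0"
    by (simp add: power2_eq_square algebra_simps)
  obtain C S :: "complex \<Rightarrow> complex" and C' S' where
    CS: "\<And>x. (C has_field_derivative C' x) (at x)" "\<And>x. (S has_field_derivative S' x) (at x)"
      "\<And>x. (C x)^2 - x * (S x)^2 = 1" "C 0 = 1" "S 0 = 1"
    using entire_cosh_sqrt by metis
  \<comment> \<open>On the flex tangent y = m x + c z the cubic is -(x - x1 z)^3, so the surface has
    three lines over it, where x - x1 z is minus a cube root of unity. With the \<open>p\<close>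
    below x - x1 z = u - 1; the root 1 would give u = 0, so \<omega> is used.\<close>
  define u0 where "u0 = 1 - \<omega>"
  \<comment> \<open>With \<sigma> = \<open>\<tau> $ 1\<close>, setting x = u p - 1 and z = u
    \<sigma> parametrizes the plane \<sigma> (x + 1) = p z by u and y.\<close>
  define p where "p = (\<lambda>\<tau> :: complex^2. 1 + x1 * \<tau> $ 1)"
  define A where "A = (\<lambda>\<tau> :: complex^2. p \<tau> * p \<tau> * p \<tau> + a * (\<tau> $ 1 * \<tau> $ 1) * p \<tau> + b * (\<tau> $ 1 * \<tau> $ 1 * \<tau> $ 1))"
  define B where "B = (\<lambda>\<tau> :: complex^2. - 3 * (p \<tau> * p \<tau>) - a * (\<tau> $ 1 * \<tau> $ 1))"
  define D where "D = (\<lambda>\<tau> :: complex^2. 4 * A \<tau> * \<tau> $ 1)"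
  define y0 where "y0 = (\<lambda>\<tau> :: complex^2. m * (u0 * p \<tau> - 1) + c * u0 * \<tau> $ 1)"
  define V where "V = (\<lambda>\<tau> :: complex^2. 2 * A \<tau> * u0 + B \<tau>)"
  define ch where "ch = (\<lambda>\<tau> :: complex^2. C (D \<tau> * (\<tau> $ 2 * \<tau> $ 2)))"
  define sh where "sh = (\<lambda>\<tau> :: complex^2. \<tau> $ 2 * S (D \<tau> * (\<tau> $ 2 * \<tau> $ 2)))"
  \<comment> \<open>This follows u' = 2 \<sigma> y, y' = 2 A u + B from (u0, y0) for the time 2 w,
    where w = \<open>\<tau> $ 2\<close>. The equations preserve the conic and give y'' = D y;
    double-angle formulas express the solution by \<open>ch\<close> and \<open>sh\<close> without
    dividing by \<open>D\<close>.\<close>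
  define u where "u = (\<lambda>\<tau> :: complex^2. u0 + 4 * \<tau> $ 1 * (y0 \<tau> * (ch \<tau> * sh \<tau>) + V \<tau> * (sh \<tau> * sh \<tau>)))"
  define y where "y = (\<lambda>\<tau> :: complex^2. y0 \<tau> + 2 * (y0 \<tau> * D \<tau> * (sh \<tau> * sh \<tau>) + V \<tau> * (ch \<tau> * sh \<tau>)))"
  define x where "x = (\<lambda>\<tau> :: complex^2. u \<tau> * p \<tau> - 1)"
  define z where "z = (\<lambda>\<tau> :: complex^2. u \<tau> * \<tau> $ 1)"
  have pyth: "(ch \<tau>)^2 = 1 + D \<tau> * (sh \<tau>)^2" for \<tau>
    using CS(3)[of "D \<tau> * (\<tau> $ 2 * \<tau> $ 2)"]
    by (simp add: ch_def sh_def power_mult_distrib power2_eq_square algebra_simps)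
  have u0: "u0 \<noteq> 0" "2 * u0 - 3 \<noteq> 0"
  proof -
    have "u0^2 = 3 * u0 - 3" "(2 * u0 - 3)^2 = - 3"
      using \<omega> unfolding u0_def by algebra+
    then show "u0 \<noteq> 0" "2 * u0 - 3 \<noteq> 0" by auto
  qed
  define G where "G \<tau> U W = A \<tau> * U^2 + B \<tau> * U + 3 * p \<tau> - \<tau> $ 1 * W^2" for \<tau> U W
  \<comment> \<open>The factor \<open>U\<close> is the line common to all the planes; the conic
    \<open>G = 0\<close> is what remains.\<close>
  have conic: "W^2 * (U * \<tau> $ 1) - (U * p \<tau> - 1)^3 - a * (U * p \<tau> - 1) * (U * \<tau> $ 1)^2 - b * (U * \<tau> $ 1)^3
      = 1 - U * G \<tau> U W" for \<tau> U W
    unfolding G_def A_def B_def by algebra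
  \<comment> \<open>This is the section: x - x1 z = u0 - 1 = - \<omega> for every \<sigma>, and
    \<omega>^3 = 1.\<close>
  have "(y0 \<tau>)^2 * (u0 * \<tau> $ 1) - (u0 * p \<tau> - 1)^3 - a * (u0 * p \<tau> - 1) * (u0 * \<tau> $ 1)^2 - b * (u0 * \<tau> $ 1)^3 = 1" for \<tau>
    using x1 \<omega> unfolding y0_def p_def u0_def by algebra
  then have G0: "G \<tau> u0 (y0 \<tau>) = 0" for \<tau>
    unfolding conic using u0 by simp
  have G: "G \<tau> (u \<tau>) (y \<tau>) = 0" for \<tau>
    using G0[of \<tau>] pyth[of \<tau>] unfolding G_def u_def y_def D_def V_def by algebra
  have 1: "(y \<tau>)^2 * z \<tau> - (x \<tau>)^3 - a * x \<tau> * (z \<tau>)^2 - b * (z \<tau>)^3 = 1" for \<tau>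
    unfolding x_def z_def conic G by simp
  note entire2_ch = entire2_compose[of C, OF CS(1)] and entire2_sh = entire2_compose[of S, OF CS(2)]
  have ent: "entire2 D" "entire2 V" "entire2 ch" "entire2 x" "entire2 y" "entire2 z"
    unfolding D_def V_def x_def y_def z_def u_def ch_def sh_def D_def V_def y0_def A_def B_def p_def
    by (intro entire2_intros entire2_ch entire2_sh)+
  \<comment> \<open>The values of these partials do not matter: at the origin they are multiplied by
    \<open>\<tau> $ 1\<close>, \<open>\<tau> $ 2\<close> or \<open>sh 0\<close>, all 0.\<close>
  obtain D1 D2 V1 V2 ch1 ch2 where ex: "has_partials D D1 D2 0" "has_partials V V1 V2 0" "has_partials ch ch1 ch2 0"
    using ent unfolding entire2_def by meson
  obtain S1 S2 where S: "has_partials (\<lambda>\<tau>. S (D \<tau> * (\<tau> $ 2 * \<tau> $ 2))) S1 S2 0"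
    using has_partials_compose[OF CS(2)] has_partials_intros ex(1) by meson
  have 0: "sh 0 = 0" "ch 0 = 1" "D 0 = 0" "V 0 = 2 * u0 - 3" "p 0 = 1" "u 0 = u0" "y0 0 = m * (u0 - 1)"
    by (simp_all add: sh_def ch_def D_def V_def A_def B_def p_def u_def y0_def CS(4))
  have p: "has_partials p x1 0 0"
    unfolding p_def by (rule has_partials_eq_rhs, (rule has_partials_intros)+) simp_all
  have y0: "has_partials y0 (m * u0 * x1 + c * u0) 0 0"
    unfolding y0_def by (rule has_partials_eq_rhs, (rule has_partials_intros p)+) simp_all
  have sh: "has_partials sh 0 1 0"
    unfolding sh_def by (rule has_partials_eq_rhs, (rule has_partials_intros S)+) (simp_all add: CS(5))
  have u: "has_partials u 0 0 0"
    unfolding u_def by (rule has_partials_eq_rhs, (rule has_partials_intros ex y0 sh)+) (simp_all add: 0)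
  have y: "has_partials y (m * u0 * x1 + c * u0) (2 * (2 * u0 - 3)) 0"
    unfolding y_def by (rule has_partials_eq_rhs, (rule has_partials_intros ex y0 sh)+) (simp_all add: 0)
  have x: "has_partials x (u0 * x1) 0 0"
    unfolding x_def by (rule has_partials_eq_rhs, (rule has_partials_intros u p)+) (simp_all add: 0)
  have z: "has_partials z u0 0 0"
    unfolding z_def by (rule has_partials_eq_rhs, (rule has_partials_intros u)+) (simp_all add: 0)
  have "x 0 = - \<omega>" "z 0 = 0"
    by (simp_all add: x_def z_def 0 u0_def)
  moreover have "\<omega> \<noteq> 0"
    using \<omega> by auto
  \<comment> \<open>The determinant equals 2 \<omega> u0 (2 u0 - 3).\<close>
  ultimately show thesis
    using u0 by (intro that[of x y z "vector [u0 * x1, 0]" "vector [m * u0 * x1 + c * u0, 2 * (2 * u0 - 3)]" "vector [u0, 0]"])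
      (use y in \<open>simp_all add: ent 1 x z det_3\<close>)
qed

section \<open>Transfer to an arbitrary smooth cubic\<close>

text \<open>The linear term of the expansion at v shows that the i-th partial derivative is
  \<open>3 * T v v (axis i 1)\<close>.\<close>

lemma nonsingular_if_partial_deriv:
  assumes "symmetric_trilinear T" "\<And>v. F v = T v v v"
    and "\<And>v. v \<noteq> 0 \<Longrightarrow> F v = 0 \<Longrightarrow> \<exists>i. partial_deriv i F v \<noteq> 0"
  shows "symmetric_trilinear.nonsingular T"
proof -
  interpret symmetric_trilinear T by fact
  have "partial_deriv i F v = 3 * T v v (axis i 1)" for i v
  proof -
    define e where "e = axis i (1 :: complex)"
    have "F (v + t *s e) = T v v v + 3 * T v v e * t + 3 * T v e e * t^2 + T e e e * t^3" for t
      using cubic_expand[of 1 v t e 0 0] by (simp add: assms(2) zero3)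
    moreover have "((\<lambda>t. T v v v + 3 * T v v e * t + 3 * T v e e * t^2 + T e e e * t^3)
        has_field_derivative 3 * T v v e) (at 0)"
      by (auto intro!: derivative_eq_intros)
    ultimately show ?thesis
      unfolding partial_deriv_def e_def by (simp add: DERIV_imp_deriv)
  qed
  then show ?thesis
    using assms(2,3) unfolding nonsingular_def by (metis mult_zero_right)
qed

theorem proposition5p1:
  assumes "smooth_plane_curve 3 C"
  shows "dominable_by_C2 (top_of_set (- C)) (cp2_atlas_on (- C))"
proof -
  obtain q where C: "C = {cpoint v |v. v \<noteq> 0 \<and> ternary_form 3 q v = 0}"
    and smooth: "\<And>v. v \<noteq> 0 \<Longrightarrow> ternary_form 3 q v = 0 \<Longrightarrow> \<exists>i. partial_deriv i (ternary_form 3 q) v \<noteq> 0"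
    using assms by (auto simp: smooth_plane_curve_def)
  obtain T where T: "symmetric_trilinear T" "\<And>v. ternary_form 3 q v = T v v v"
    using ternary_cubic_polarization by blast
  interpret symmetric_trilinear T by fact
  obtain e p f a b where det: "det3 e p f \<noteq> 0"
    and weierstrass: "\<forall>x y z. T (x *s e + y *s p + z *s f) (x *s e + y *s p + z *s f) (x *s e + y *s p + z *s f)
      = y^2 * z - x^3 - a * x * z^2 - b * z^3"
    using nonsingular_if_partial_deriv[OF T smooth] by (rule weierstrass_form)
  obtain x y z and X Y Z :: "complex^2" where entire: "entire2 x" "entire2 y" "entire2 z"
    and one: "\<forall>\<tau>. (y \<tau>)^2 * z \<tau> - (x \<tau>)^3 - a * x \<tau> * (z \<tau>)^2 - b * (z \<tau>)^3 = 1"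
    and partials: "has_partials x (X $ 1) (X $ 2) 0" "has_partials y (Y $ 1) (Y $ 2) 0" "has_partials z (Z $ 1) (Z $ 2) 0"
    and det0: "det3 (vector [x 0, y 0, z 0]) (vector [X $ 1, Y $ 1, Z $ 1]) (vector [X $ 2, Y $ 2, Z $ 2]) \<noteq> 0"
    by (rule weierstrass_map)
  define g where "g \<tau> = x \<tau> *s e + y \<tau> *s p + z \<tau> *s f" for \<tau>
  have g1: "ternary_form 3 q (g \<tau>) = 1" for \<tau>
    unfolding T(2) g_def using weierstrass one by simp
  have g0: "g \<tau> \<noteq> 0" for \<tau>
    using g1[of \<tau>] by (auto simp: T(2) zero3)
  show ?thesis
  proof (rule dominable_by_lift)
    show "entire2 (\<lambda>\<tau>. g \<tau> $ k)" for k
      unfolding g_def vector_add_component vector_smult_component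
      by (intro entire2_intros entire)
    show "g \<tau> \<noteq> 0" for \<tau> by (rule g0)
    \<comment> \<open>By homogeneity the form vanishes at every representative of a point of C, but
      it is 1 at \<open>g \<tau>\<close>.\<close>
    show "cpoint (g \<tau>) \<in> - C" for \<tau>
    proof
      assume "cpoint (g \<tau>) \<in> C"
      then obtain v where v: "cpoint (g \<tau>) = cpoint v" "v \<noteq> 0" "ternary_form 3 q v = 0"
        using C by auto
      then obtain c where "g \<tau> = c *s v"
        using cpoint_eq_iff g0 by blast
      then show False
        using g1[of \<tau>] v(3) by (simp add: ternary_form_smult)
    qed
    show "has_partials (\<lambda>\<tau>. g \<tau> $ k) ((X $ 1 *s e + Y $ 1 *s p + Z $ 1 *s f) $ k)
        ((X $ 2 *s e + Y $ 2 *s p + Z $ 2 *s f) $ k) 0" for k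
      unfolding g_def vector_add_component vector_smult_component
      by (rule has_partials_eq_rhs, (rule has_partials_intros partials)+) simp_all
    show "det (vector [g 0, X $ 1 *s e + Y $ 1 *s p + Z $ 1 *s f, X $ 2 *s e + Y $ 2 *s p + Z $ 2 *s f]) \<noteq> 0"
      unfolding g_def det3_coords using det det0 by simp
  qed
qed

end
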